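(* Let $m,k\ge1$ be integers. Then $$\mathtt{PF}^{(m)}\big(\mathcal A^{mk}\big)=\frac1{k!}\sum_{c\in LQ(m,k)}\varepsilon(c),$$ where $\mathcal A^{mk}$ is the antisymmetric tensor of order $mk$ with indices in $\{1,\dots,mk\}$ normalized by $\mathcal A^{mk}_{1,\dots,mk}=1$, $LQ(m,k)$ is the set of $(m,k)$-latin quasisquares, and $\varepsilon(c)$ is the sign of the quasisquare $c$.
   Context: Hyperpfaffian. For integers $m,n,k\ge1$ and a tensor $M=(M_{i_1,\dots,i_{mk}})_{1\le i_1,\dots,i_{mk}\le mn}$, $$\mathtt{PF}^{(m)}(M):=\frac1{n!}\sum \epsilon(\sigma_1)\cdots\epsilon(\sigma_k)\prod_{i=1}^n M_{\sigma_1((i-1)m+1),\dots,\sigma_1(im),\,\dots,\,\sigma_k((i-1)m+1),\dots,\sigma_k(im)},$$ where the sum runs over all $k$-tuples $(\sigma_1,\dots,\sigma_k)$ of permutations of $\{1,\dots,mn\}$ such that $\sigma_j((i-1)m+1)<\cdots<\sigma_j(im)$ for all $1\le j\le k$, $1\le i\le n$, and $\epsilon$ is the signature. For $\mathcal A^{mk}$ this is used with $n=k$. Antisymmetric tensor. $\mathcal A^{N}$ is the unique antisymmetric tensor of order $N$ with all indices in $\{1,\dots,N\}$ such that $\mathcal A^N_{1,\dots,N}=1$; i.e. $\mathcal A^N_{\tau(1),\dots,\tau(N)}=\epsilon(\tau)$ for every permutation $\tau$ of $\{1,\dots,N\}$ and all other entries are $0$. Latin quasisquares. A $(m,k)$-latin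 quasisquare is a $k\times mk$ matrix of the form $$\left[\begin{array}{ccccccc} \sigma_1(1)&\cdots&\sigma_1(m)&\cdots&\sigma_k(1)&\cdots&\sigma_k(m)\\ \vdots&&\vdots&\cdots&\vdots&&\vdots\\ \sigma_1((k-1)m+1)&\cdots&\sigma_1(km)&\cdots&\sigma_k((k-1)m+1)&\cdots&\sigma_k(km) \end{array}\right]$$ (row $r$ is the concatenation over $i=1,\dots,k$ of $\sigma_i((r-1)m+1),\dots,\sigma_i(rm)$), where each $\sigma_i$ is a permutation of $\{1,\dots,km\}$ and each row is (the word $\tau(1),\dots,\tau(km)$ of) a permutation $\tau$ of $\{1,\dots,km\}$ satisfying $\tau((\ell-1)m+1)<\cdots<\tau(\ell m)$ for every $1\le\ell\le k$. $LQ(m,k)$ denotes the set of all $(m,k)$-latin quasisquares. The sign $\varepsilon(c)$ of $c\in LQ(m,k)$ is the product of the signs of the permutations $\sigma_1,\dots,\sigma_k$ and of the signs of the $k$ rows (viewed as permutations). *)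

theory Defs
  imports "HOL-Combinatorics.Permutations" "HOL-Library.FuncSet" "Jordan_Normal_Form.Matrix"
begin

text \<open>
  Permutations of \<open>{1..N}\<close> are functions with \<open>p permutes {1..N}\<close>; their signature is
  the library's \<^const>\<open>sign\<close>. An entry of a tensor of order \<open>d\<close> is addressed by the
  list of its \<open>d\<close> indices, which are counted from 1.
\<close>

definition index_block :: "nat \<Rightarrow> nat \<Rightarrow> nat list" where
  "index_block m i = [(i - 1) * m + 1 ..< i * m + 1]"

definition block_perms :: "nat \<Rightarrow> nat \<Rightarrow> (nat \<Rightarrow> nat) set" where
  "block_perms m n = {\<tau>. \<tau> permutes {1..m * n} \<and>
     (\<forall>i\<in>{1..n}. strict_mono_on (set (index_block m i)) \<tau>)}"

text \<open>
  The tuples \<open>(\<sigma> 1, \<dots>, \<sigma> k)\<close> are extensional functions on \<open>{1..k}\<close>, so that each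
  tuple is counted once.
\<close>

definition hyperpfaffian ::
    "nat \<Rightarrow> nat \<Rightarrow> nat \<Rightarrow> (nat list \<Rightarrow> 'a) \<Rightarrow> 'a::field_char_0" where
  "hyperpfaffian m n k M =
     1 / fact n *
     (\<Sum>\<sigma> \<in> {1..k} \<rightarrow>\<^sub>E block_perms m n.
        (\<Prod>j = 1..k. of_int (sign (\<sigma> j))) *
        (\<Prod>i = 1..n. M (concat (map (\<lambda>j. map (\<sigma> j) (index_block m i)) [1..<k + 1]))))"

text \<open>The permutation with one-line notation \<open>w\<close> (it fixes everything beyond the length of \<open>w\<close>).\<close>

definition word_perm :: "nat list \<Rightarrow> nat \<Rightarrow> nat" where
  "word_perm w x = (if x \<in> {1..length w} then w ! (x - 1) else x)"

definition antisym_tensor :: "nat \<Rightarrow> nat list \<Rightarrow> 'a::field_char_0" where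
  "antisym_tensor N w =
     (if length w = N \<and> word_perm w permutes {1..N} then of_int (sign (word_perm w)) else 0)"

text \<open>
  Rows and columns of the type \<open>mat\<close> are counted from 0: column \<open>s\<close> belongs to
  \<open>\<sigma> (s div m + 1)\<close>, and row \<open>r\<close> displays the values of the \<open>\<sigma> i\<close> on
  \<open>index_block m (r + 1)\<close>.
\<close>

definition quasisquare :: "nat \<Rightarrow> nat \<Rightarrow> (nat \<Rightarrow> nat \<Rightarrow> nat) \<Rightarrow> nat mat" where
  "quasisquare m k \<sigma> = mat k (m * k) (\<lambda>(r, s). \<sigma> (s div m + 1) (r * m + s mod m + 1))"

definition row_perm :: "nat mat \<Rightarrow> nat \<Rightarrow> nat \<Rightarrow> nat" where
  "row_perm c r = word_perm (list_of_vec (row c (r - 1)))"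

text \<open>
  This recovers \<open>\<sigma> i\<close> from the matrix; see the lemma \<open>column_perm_quasisquare\<close>.
\<close>

definition column_perm :: "nat \<Rightarrow> nat mat \<Rightarrow> nat \<Rightarrow> nat \<Rightarrow> nat" where
  "column_perm m c i = word_perm
     (map (\<lambda>x. c $$ (x div m, (i - 1) * m + x mod m)) [0..<m * dim_row c])"

definition LQ :: "nat \<Rightarrow> nat \<Rightarrow> nat mat set" where
  "LQ m k = {quasisquare m k \<sigma> | \<sigma>.
     (\<forall>i\<in>{1..k}. \<sigma> i permutes {1..m * k}) \<and>
     (\<forall>r\<in>{1..k}. row_perm (quasisquare m k \<sigma>) r \<in> block_perms m k)}"

definition quasisquare_sign :: "nat \<Rightarrow> nat mat \<Rightarrow> int" where
  "quasisquare_sign m c =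
     (\<Prod>i = 1..dim_row c. sign (column_perm m c i)) * (\<Prod>r = 1..dim_row c. sign (row_perm c r))"

lemma column_perm_quasisquare:
  assumes i: "i \<in> {1..k}" and p: "\<sigma> i permutes {1..m * k}"
  shows "column_perm m (quasisquare m k \<sigma>) i = \<sigma> i"
proof
  fix x
  show "column_perm m (quasisquare m k \<sigma>) i x = \<sigma> i x"
  proof (cases "x \<in> {1..m * k}")
    case False
    then show ?thesis
      using permutes_not_in[OF p False] by (auto simp: column_perm_def word_perm_def quasisquare_def)
  next
    case True
    define y where "y = x - 1"
    have y: "x = y + 1" "y < m * k" using True by (auto simp: y_def)
    then have m: "m > 0" by (cases m) auto
    have a: "y div m < k" using y m by (simp add: less_mult_imp_div_less mult.commute)
    have "(i - 1) * m + y mod m < (i - 1) * m + m" using m by simp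
    also have "\<dots> = i * m" using i by (cases i) auto
    also have "\<dots> \<le> m * k" using i by (simp add: mult.commute)
    finally have b: "(i - 1) * m + y mod m < m * k" .
    have "y div m * m + y mod m = y" by simp
    then show ?thesis using y a b i m
      by (auto simp: column_perm_def word_perm_def quasisquare_def)
  qed
qed

text \<open>
  \<^const>\<open>antisym_tensor\<close> is the unique antisymmetric tensor of order \<open>N\<close> with indices in
  \<open>{1..N}\<close> whose entry at \<open>1, \<dots>, N\<close> is 1.
\<close>

definition antisymmetric_tensor :: "nat \<Rightarrow> nat \<Rightarrow> (nat list \<Rightarrow> 'a::field_char_0) \<Rightarrow> bool" where
  "antisymmetric_tensor d N M \<longleftrightarrow>
     (\<forall>w i j. length w = d \<longrightarrow> set w \<subseteq> {1..N} \<longrightarrow> i < j \<longrightarrow> j < d \<longrightarrow>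
        M (w[i := w ! j, j := w ! i]) = - M w)"

lemma word_perm_map:
  assumes "\<tau> permutes {1..N}"
  shows "word_perm (map \<tau> [1..<N + 1]) = \<tau>"
proof
  fix x
  show "word_perm (map \<tau> [1..<N + 1]) x = \<tau> x"
    using permutes_not_in[OF assms, of x]
    by (auto simp: word_perm_def simp del: upt_Suc)
qed

lemma map_word_perm:
  assumes "length w = N"
  shows "map (word_perm w) [1..<N + 1] = w"
  using assms by (intro nth_equalityI) (auto simp: word_perm_def simp del: upt_Suc)

lemma word_perm_swap:
  assumes "i < j" "j < length w"
  shows "word_perm (w[i := w ! j, j := w ! i]) = word_perm w \<circ> transpose (Suc i) (Suc j)"
proof
  fix x
  show "word_perm (w[i := w ! j, j := w ! i]) x = (word_perm w \<circ> transpose (Suc i) (Suc j)) x"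
    using assms by (cases x) (auto simp: word_perm_def transpose_def nth_list_update)
qed

lemma word_perm_permutes:
  assumes "length w = N" "set w \<subseteq> {1..N}" "distinct w"
  shows "word_perm w permutes {1..N}"
proof (rule bij_imp_permutes)
  have inj: "inj_on (word_perm w) {1..N}"
    using assms by (auto simp: inj_on_def word_perm_def nth_eq_iff_index_eq)
  have "word_perm w ` {1..N} \<subseteq> {1..N}"
  proof
    fix y assume "y \<in> word_perm w ` {1..N}"
    then obtain x where "x \<in> {1..N}" "y = w ! (x - 1)"
      using assms(1) by (auto simp: word_perm_def)
    then have "y \<in> set w" using assms(1) by auto
    then show "y \<in> {1..N}" using assms(2) by auto
  qed
  then show "bij_betw (word_perm w) {1..N} {1..N}"
    using inj by (simp add: bij_betw_def endo_inj_surj)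
qed (use assms in \<open>auto simp: word_perm_def\<close>)

lemma antisymmetric_antisym_tensor: "antisymmetric_tensor N N (antisym_tensor N)"
  unfolding antisymmetric_tensor_def
proof (intro allI impI)
  fix w :: "nat list" and i j
  assume w: "length w = N" "i < j" "j < N"
  let ?t = "transpose (Suc i) (Suc j)" and ?w = "w[i := w ! j, j := w ! i]"
  have wp: "word_perm ?w = word_perm w \<circ> ?t" using w by (simp add: word_perm_swap)
  have t: "?t permutes {1..N}" using w by (intro permutes_swap_id) auto
  have "(word_perm w \<circ> ?t) \<circ> ?t = word_perm w" by (auto simp: fun_eq_iff)
  then have iff: "word_perm ?w permutes {1..N} \<longleftrightarrow> word_perm w permutes {1..N}"
    unfolding wp using permutes_compose[OF t] by metis
  have "sign (word_perm ?w) = - sign (word_perm w)" if p: "word_perm w permutes {1..N}"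
    using w permutes_imp_permutation[OF _ p] unfolding wp
    by (simp add: sign_compose permutation_swap_id sign_swap_id)
  then show "antisym_tensor N ?w = - antisym_tensor N w"
    using w iff by (simp add: antisym_tensor_def)
qed

lemma antisym_tensor_unique:
  fixes M :: "nat list \<Rightarrow> 'a::field_char_0"
  assumes M: "antisymmetric_tensor N N M" and one: "M [1..<N + 1] = 1"
    and w: "length w = N" "set w \<subseteq> {1..N}"
  shows "M w = antisym_tensor N w"
proof (cases "distinct w")
  case False
  then obtain i j where ij: "i < j" "j < N" "w ! i = w ! j"
    using w(1) by (metis distinct_conv_nth linorder_neqE_nat)
  have same: "w[i := w ! j, j := w ! i] = w"
    using ij w by (metis list_update_id)
  have zero: "L w = 0" if "antisymmetric_tensor N N L" for L :: "nat list \<Rightarrow> 'a"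
  proof -
    have "L w = - L w" using that ij w same unfolding antisymmetric_tensor_def by metis
    then show ?thesis by (simp add: eq_neg_iff_add_eq_0 flip: mult_2)
  qed
  show ?thesis using zero[OF M] zero[OF antisymmetric_antisym_tensor] by simp
next
  case True
  have "M (map \<tau> [1..<N + 1]) = of_int (sign \<tau>)" if "\<tau> permutes {1..N}" for \<tau>
    using finite_atLeastAtMost that
  proof (induction rule: permutes_rev_induct)
    case id
    then show ?case using one by (simp add: sign_id)
  next
    case (swap a b p)
    show ?case
    proof (cases "a = b")
      case True
      then show ?thesis using swap by simp
    next
      case ne: False
      have key: "M (map (p \<circ> transpose a b) [1..<N + 1]) = of_int (sign (p \<circ> transpose a b))"
        if ab: "a < b" "a \<in> {1..N}" "b \<in> {1..N}" for a b
      proof -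
        let ?u = "map p [1..<N + 1]"
        have "map (p \<circ> transpose a b) [1..<N + 1] = ?u[a - 1 := ?u ! (b - 1), b - 1 := ?u ! (a - 1)]"
          using ab by (intro nth_equalityI)
            (auto simp: nth_list_update transpose_def simp del: upt_Suc)
        moreover have "set ?u \<subseteq> {1..N}"
          using permutes_image[OF swap(4)] by (auto simp del: upt_Suc)
        moreover have "sign (p \<circ> transpose a b) = - sign p"
          using ab permutes_imp_permutation[OF _ swap(4)]
          by (simp add: sign_compose permutation_swap_id sign_swap_id)
        moreover have "a - 1 < b - 1" "b - 1 < N" "length ?u = N" using ab by auto
        ultimately show ?thesis using M swap(5) unfolding antisymmetric_tensor_def
          by (metis of_int_minus)
      qed
      show ?thesis
        using key[of a b] key[of b a] ne swap(1,2) by (metis linorder_neqE_nat transpose_commute)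
    qed
  qed
  from this[OF word_perm_permutes[OF w True]] show ?thesis
    using word_perm_permutes[OF w True] map_word_perm[OF w(1)] w by (simp add: antisym_tensor_def)
qed

lemma antisym_tensor_perm:
  assumes "\<tau> permutes {1..N}"
  shows "antisym_tensor N (map \<tau> [1..<N + 1]) = of_int (sign \<tau>)"
  using assms word_perm_map[OF assms] by (simp add: antisym_tensor_def del: upt_Suc)

end

theory Submission imports Defs begin

text \<open>
  The rows of a quasisquare are exactly the index words at which the hyperpfaffian evaluates the
  tensor (\<open>list_of_row_quasisquare\<close>). Hence, for the antisymmetric tensor, the summand of a tuple
  \<open>\<sigma>\<close> vanishes unless every row is a permutation, and is otherwise the product of the signs of
  all columns and all rows, i.e. the sign of the quasisquare of \<open>\<sigma>\<close>.

  What remains is that the tuples with nonzero summand correspond bijectively to the quasisquares.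
  The two sides impose their order condition in different places: the hyperpfaffian on the
  \<open>\<sigma> l\<close>, the quasisquares on the rows. Both speak about the same entries, since the \<open>l\<close>-th block
  of row \<open>r\<close> lists the values of \<open>\<sigma> l\<close> on the \<open>r\<close>-th index block
  (\<open>strict_mono_on_row_perm_iff\<close>). This makes the map from tuples to quasisquares surjective
  (\<open>LQ_eq_image\<close>); it is injective because \<open>\<sigma>\<close> can be read off the columns.
\<close>

lemma concat_map_uniform_blocks:
  "concat (map (\<lambda>j. map (f j) [0..<m]) [0..<k]) = map (\<lambda>s. f (s div m) (s mod m)) [0..<k * m]"
proof (induction k)
  case 0
  then show ?case by simp
next
  case (Suc k)
  have "[0..<Suc k * m] = [0..<k * m] @ map (\<lambda>t. k * m + t) [0..<m]"
    by (intro nth_equalityI) (auto simp: nth_append)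
  with Suc show ?case by (auto simp: div_mult_self3)
qed

lemma index_block_eq_map:
  assumes "i \<ge> 1"
  shows "index_block m i = map (\<lambda>t. (i - 1) * m + t + 1) [0..<m]"
proof -
  have "i * m = (i - 1) * m + m"
    using assms by (cases i) auto
  then show ?thesis
    by (intro nth_equalityI) (auto simp: index_block_def simp del: upt_Suc)
qed

lemma strict_mono_on_index_block_iff:
  fixes f :: "nat \<Rightarrow> nat"
  assumes "i \<ge> 1"
  shows "strict_mono_on (set (index_block m i)) f \<longleftrightarrow>
    strict_mono_on {..<m} (\<lambda>t. f ((i - 1) * m + t + 1))"
  unfolding index_block_eq_map[OF assms] by (auto simp: strict_mono_on_def)

lemma dim_row_quasisquare [simp]: "dim_row (quasisquare m k \<sigma>) = k"
  by (simp add: quasisquare_def)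

lemma quasisquare_cong:
  assumes "\<And>i. i \<in> {1..k} \<Longrightarrow> \<sigma> i = \<sigma>' i"
  shows "quasisquare m k \<sigma> = quasisquare m k \<sigma>'"
  unfolding quasisquare_def
proof (intro cong_mat refl)
  fix r s assume "s < m * k"
  then have "s div m + 1 \<in> {1..k}"
    by (simp add: less_mult_imp_div_less mult.commute Suc_le_eq)
  then show "(case (r, s) of (r, s) \<Rightarrow> \<sigma> (s div m + 1) (r * m + s mod m + 1)) =
      (case (r, s) of (r, s) \<Rightarrow> \<sigma>' (s div m + 1) (r * m + s mod m + 1))"
    using assms by simp
qed

lemma list_of_row_quasisquare:
  assumes r: "r \<in> {1..k}"
  shows "list_of_vec (row (quasisquare m k \<sigma>) (r - 1)) =
    concat (map (\<lambda>j. map (\<sigma> j) (index_block m r)) [1..<k + 1])"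
proof -
  have "[1..<k + 1] = map Suc [0..<k]" by (simp add: map_Suc_upt del: upt_Suc)
  then have "concat (map (\<lambda>j. map (\<sigma> j) (index_block m r)) [1..<k + 1]) =
      concat (map (\<lambda>j. map (\<lambda>t. \<sigma> (j + 1) ((r - 1) * m + t + 1)) [0..<m]) [0..<k])"
    using r by (simp add: index_block_eq_map o_def del: upt_Suc)
  also have "\<dots> = map (\<lambda>s. \<sigma> (s div m + 1) ((r - 1) * m + s mod m + 1)) [0..<k * m]"
    by (rule concat_map_uniform_blocks)
  also have "\<dots> = list_of_vec (row (quasisquare m k \<sigma>) (r - 1))"
    using r by (intro nth_equalityI) (auto simp: quasisquare_def mult.commute list_of_vec_index)
  finally show ?thesis by simp
qed

lemma row_perm_quasisquare_block:
  assumes r: "r \<in> {1..k}" and l: "l \<in> {1..k}" and t: "t < m"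
  shows "row_perm (quasisquare m k \<sigma>) r ((l - 1) * m + t + 1) = \<sigma> l ((r - 1) * m + t + 1)"
proof -
  have "(l - 1) * m + t < (l - 1) * m + m" using t by simp
  also have "\<dots> = l * m" using l by (cases l) auto
  also have "\<dots> \<le> m * k" using l by (simp add: mult.commute)
  finally have "(l - 1) * m + t < m * k" .
  moreover have "r - 1 < k" "Suc (l - 1) = l" using r l by auto
  ultimately show ?thesis
    using t by (simp add: row_perm_def word_perm_def quasisquare_def list_of_vec_index)
qed

text \<open>
  Row \<open>r\<close> meets the columns of \<open>\<sigma> l\<close> in \<open>m\<close> entries, and both sides say that these increase.
\<close>

lemma strict_mono_on_row_perm_iff:
  assumes r: "r \<in> {1..k}" and l: "l \<in> {1..k}"
  shows "strict_mono_on (set (index_block m l)) (row_perm (quasisquare m k \<sigma>) r) \<longleftrightarrow>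
    strict_mono_on (set (index_block m r)) (\<sigma> l)"
proof -
  have "1 \<le> l" "1 \<le> r" using r l by auto
  then show ?thesis
    unfolding strict_mono_on_index_block_iff[OF \<open>1 \<le> l\<close>] strict_mono_on_index_block_iff[OF \<open>1 \<le> r\<close>]
    using row_perm_quasisquare_block[OF r l] by (simp add: strict_mono_on_def)
qed

text \<open>
  There are as many rows as tuple components and as many blocks of each. So, over all pairs
  \<open>(r, l)\<close>, the order conditions on the rows and those on the \<open>\<sigma> l\<close> are the same set of
  conditions, and they can be moved from one side to the other.
\<close>

lemma rows_and_columns_block_perms_iff:
  "(\<forall>i\<in>{1..k}. \<sigma> i permutes {1..m * k}) \<and>
     (\<forall>r\<in>{1..k}. row_perm (quasisquare m k \<sigma>) r \<in> block_perms m k) \<longleftrightarrow>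
   (\<forall>i\<in>{1..k}. \<sigma> i \<in> block_perms m k) \<and>
     (\<forall>r\<in>{1..k}. row_perm (quasisquare m k \<sigma>) r permutes {1..m * k})"
  using strict_mono_on_row_perm_iff[of _ k _ m \<sigma>] unfolding block_perms_def by blast

definition latin_tuples :: "nat \<Rightarrow> nat \<Rightarrow> (nat \<Rightarrow> nat \<Rightarrow> nat) set" where
  "latin_tuples m k = {\<sigma> \<in> {1..k} \<rightarrow>\<^sub>E block_perms m k.
     \<forall>r\<in>{1..k}. row_perm (quasisquare m k \<sigma>) r permutes {1..m * k}}"

lemma LQ_eq_image: "LQ m k = quasisquare m k ` latin_tuples m k"
proof (intro equalityI subsetI)
  fix c assume "c \<in> LQ m k"
  then obtain \<sigma> where c: "c = quasisquare m k \<sigma>"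
    and \<sigma>: "\<forall>i\<in>{1..k}. \<sigma> i \<in> block_perms m k"
      "\<forall>r\<in>{1..k}. row_perm (quasisquare m k \<sigma>) r permutes {1..m * k}"
    using rows_and_columns_block_perms_iff unfolding LQ_def by blast
  \<comment> \<open>The \<open>\<sigma>\<close> behind a quasisquare is arbitrary outside \<open>{1..k}\<close>, tuples are extensional.\<close>
  have "quasisquare m k (restrict \<sigma> {1..k}) = c"
    unfolding c by (rule quasisquare_cong) simp
  moreover from this have "restrict \<sigma> {1..k} \<in> latin_tuples m k"
    using \<sigma> c by (simp add: latin_tuples_def PiE_def)
  ultimately show "c \<in> quasisquare m k ` latin_tuples m k" by blast
next
  fix c assume "c \<in> quasisquare m k ` latin_tuples m k"
  then obtain \<sigma> where "c = quasisquare m k \<sigma>" "\<sigma> \<in> latin_tuples m k" by blast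
  then show "c \<in> LQ m k"
    using rows_and_columns_block_perms_iff[of k \<sigma> m] unfolding LQ_def latin_tuples_def by blast
qed

lemma column_perm_latin_tuple:
  assumes "\<sigma> \<in> latin_tuples m k" and "i \<in> {1..k}"
  shows "column_perm m (quasisquare m k \<sigma>) i = \<sigma> i"
  using assms by (intro column_perm_quasisquare) (auto simp: latin_tuples_def block_perms_def)

lemma inj_on_quasisquare: "inj_on (quasisquare m k) (latin_tuples m k)"
proof (rule inj_onI)
  fix \<sigma> \<sigma>' assume \<sigma>: "\<sigma> \<in> latin_tuples m k" "\<sigma>' \<in> latin_tuples m k"
    and eq: "quasisquare m k \<sigma> = quasisquare m k \<sigma>'"
  show "\<sigma> = \<sigma>'"
  proof (rule PiE_ext)
    show "\<sigma> \<in> {1..k} \<rightarrow>\<^sub>E block_perms m k" "\<sigma>' \<in> {1..k} \<rightarrow>\<^sub>E block_perms m k"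
      using \<sigma> by (auto simp: latin_tuples_def)
    show "\<sigma> i = \<sigma>' i" if "i \<in> {1..k}" for i
      using column_perm_latin_tuple[OF \<sigma>(1) that] column_perm_latin_tuple[OF \<sigma>(2) that] eq by simp
  qed
qed

lemma finite_block_perms: "finite (block_perms m n)"
  by (rule finite_subset[OF _ finite_permutations[of "{1..m * n}"]]) (auto simp: block_perms_def)

lemma antisym_tensor_row:
  assumes "r \<in> {1..k}"
  shows "antisym_tensor (m * k) (concat (map (\<lambda>j. map (\<sigma> j) (index_block m r)) [1..<k + 1])) =
    (if row_perm (quasisquare m k \<sigma>) r permutes {1..m * k}
     then of_int (sign (row_perm (quasisquare m k \<sigma>) r)) else 0)"
  unfolding list_of_row_quasisquare[OF assms, symmetric]
  by (simp add: antisym_tensor_def row_perm_def) (simp add: quasisquare_def)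

theorem proposition4p1:
  fixes m k :: nat
  assumes "m \<ge> 1" and "k \<ge> 1"
  shows "hyperpfaffian m k k (antisym_tensor (m * k)) =
    (1 / fact k * (\<Sum>c \<in> LQ m k. of_int (quasisquare_sign m c)) :: 'a::field_char_0)"
proof -
  let ?T = "{1..k} \<rightarrow>\<^sub>E block_perms m k"
  let ?A = "\<lambda>\<sigma> i. antisym_tensor (m * k)
    (concat (map (\<lambda>j. map (\<sigma> j) (index_block m i)) [1..<k + 1])) :: 'a"
  let ?t = "\<lambda>\<sigma>. (\<Prod>j = 1..k. of_int (sign (\<sigma> j))) * (\<Prod>i = 1..k. ?A \<sigma> i)"
  have "(\<Sum>\<sigma>\<in>?T. ?t \<sigma>) =
      (\<Sum>\<sigma>\<in>latin_tuples m k. of_int (quasisquare_sign m (quasisquare m k \<sigma>)))"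
  proof (rule sum.mono_neutral_cong_right)
    show "finite ?T" by (intro finite_PiE finite_block_perms) simp
    show "latin_tuples m k \<subseteq> ?T" by (auto simp: latin_tuples_def)
    show "\<forall>\<sigma>\<in>?T - latin_tuples m k. ?t \<sigma> = 0"
    proof
      fix \<sigma> assume "\<sigma> \<in> ?T - latin_tuples m k"
      then obtain r where r: "r \<in> {1..k}"
        "\<not> row_perm (quasisquare m k \<sigma>) r permutes {1..m * k}"
        by (auto simp: latin_tuples_def)
      then have "?A \<sigma> r = 0" by (simp only: antisym_tensor_row if_False)
      then have "(\<Prod>i = 1..k. ?A \<sigma> i) = 0" using r(1) by (intro prod_zero) blast+
      then show "?t \<sigma> = 0" by (simp only: mult_zero_right)
    qed
    show "?t \<sigma> = of_int (quasisquare_sign m (quasisquare m k \<sigma>))"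
      if \<sigma>: "\<sigma> \<in> latin_tuples m k" for \<sigma>
    proof -
      have "(\<Prod>i = 1..k. ?A \<sigma> i) =
          (\<Prod>r = 1..k. of_int (sign (row_perm (quasisquare m k \<sigma>) r)))"
        using \<sigma> by (intro prod.cong refl) (simp only: antisym_tensor_row, simp add: latin_tuples_def)
      then show ?thesis
        using column_perm_latin_tuple[OF \<sigma>] by (simp add: quasisquare_sign_def)
    qed
  qed
  also have "\<dots> = (\<Sum>c\<in>LQ m k. of_int (quasisquare_sign m c))"
    unfolding LQ_eq_image by (simp add: sum.reindex[OF inj_on_quasisquare])
  finally show ?thesis by (simp only: hyperpfaffian_def)
qed

end
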